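(* Let $p'$ be a complex number such that neither $p'$ nor $p'-\frac12$ is zero or a negative integer. Then for all complex $x,y$, with $x^{1/2},y^{1/2}$ any fixed square roots of $x,y$, $$\sum_{m,n=0}^\infty\frac{(p',m+n)(p'-1/2,m+n)(-1)^{m+n}x^{m+n}2^{-2m}}{\left(\frac{2p'-1}{4},m+n\right)\left(\frac{2p'+1}{4},m+n\right)(1/2,m)(p',n)\,m!}H_{2m}(y^{1/2})\,L_n^{(p'-1)}(-y)=\cos(4x^{1/2}y^{1/2}).$$
   Context: $(\alpha,n)=\alpha(\alpha+1)\cdots(\alpha+n-1)$ for $n\ge1$ and $(\alpha,0)=1$ (Pochhammer symbol). The Laguerre polynomial is $L_n^{(a)}(x)=\frac{(a+1,n)}{n!}\,{}_1F_1[-n;a+1;x]=\frac{1}{n!}\sum_{k=0}^n\frac{(-n,k)\,(a+1,n)}{(a+1,k)\,k!}x^k$. $H_n$ is the (physicists') Hermite polynomial, $\sum_{n\ge0}H_n(z)t^n/n!=e^{2zt-t^2}$. A double series $\sum_{m,n=0}^\infty c_{m,n}x^{m+n}$ is understood as the power series $\sum_{N=0}^\infty\big(\sum_{m+n=N}c_{m,n}\big)x^N$ in $x$. *)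

theory Defs
  imports "HOL-Complex_Analysis.Complex_Analysis"
begin

definition laguerre :: "nat \<Rightarrow> complex \<Rightarrow> complex \<Rightarrow> complex" where
  "laguerre n a x = 1 / fact n *
     (\<Sum>k=0..n. pochhammer (- of_nat n) k * pochhammer (a + 1) n
                 / (pochhammer (a + 1) k * fact k) * x ^ k)"

(* Physicists' Hermite polynomials, read off as the Taylor coefficients at t = 0 of their
   exponential generating function; the two lemmas below say that the generating function
   identity holds for every t and determines the values. *)
definition hermite :: "nat \<Rightarrow> complex \<Rightarrow> complex" where
  "hermite n z = (deriv ^^ n) (\<lambda>t. exp (2 * z * t - t ^ 2)) 0"

lemma hermite_sums: "(\<lambda>n. hermite n z * t ^ n / fact n) sums exp (2 * z * t - t ^ 2)"
proof -
  have "(\<lambda>t. exp (2 * z * t - t ^ 2)) holomorphic_on ball 0 (norm t + 1)"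
    by (intro holomorphic_intros)
  from holomorphic_power_series[OF this, of t] show ?thesis
    by (simp add: hermite_def)
qed

lemma hermite_unique:
  assumes "\<And>t. (\<lambda>n. h n * t ^ n / fact n) sums exp (2 * z * t - t ^ 2)"
  shows "h n = hermite n z"
proof -
  define f where "f = (\<lambda>t::complex. exp (2 * z * t - t ^ 2))"
  have "f has_fps_expansion Abs_fps (\<lambda>n. h n / fact n)"
    using assms by (intro has_fps_expansionI always_eventually) (simp add: f_def)
  moreover have "f has_fps_expansion Abs_fps (\<lambda>n. hermite n z / fact n)"
    using hermite_sums[of z] by (intro has_fps_expansionI always_eventually) (simp add: f_def)
  ultimately have "Abs_fps (\<lambda>n. h n / fact n) = Abs_fps (\<lambda>n. hermite n z / fact n)"
    using fps_expansion_unique_complex by blast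
  hence "h n / fact n = hermite n z / fact n"
    by (metis fps_nth_Abs_fps)
  thus ?thesis by simp
qed

end

(* Write a for p'. As 4^m (1/2,m) m! = (2m)!, the inner sums over m + n = N are, up to an explicit
   factor depending on N only, the coefficients of t^N in the product of two generating functions,
     sum_m H_{2m}(sqrt y) t^m / (2m)!  =  e^{-t} cosh (2 sqrt (y t)),
     sum_n L_n^{(a-1)}(-y) t^n / (a,n)  =  e^t 0F1(; a; y t).
   The exponentials cancel, cosh (2 sqrt (y t)) = 0F1(; 1/2; y t), and the coefficients of the
   product of two 0F1 series are summed in closed form by the Chu-Vandermonde identity. *)
theory Submission
  imports Defs
begin

text \<open>The falling factorial of a + n - 1 of length i consists of the last i factors of (a,n).
  This turns the terms 1 / ((a,n-i) i!) of a convolution into binomials whose upper entry is free of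
  i, as Vandermonde requires.\<close>

lemma gbinomial_shifted:
  fixes a :: "'a::field_char_0"
  assumes "i \<le> n" and "pochhammer a (n - i) \<noteq> 0"
  shows "(a + of_nat n - 1) gchoose i = pochhammer a n / (pochhammer a (n - i) * fact i)"
proof -
  have "pochhammer a n = pochhammer a (n - i) * pochhammer (a + of_nat (n - i)) i"
    using pochhammer_product'[of a "n - i" i] assms(1) by simp
  moreover have "a + of_nat n - 1 - of_nat i + 1 = a + of_nat (n - i)"
    using assms(1) by (simp add: of_nat_diff)
  ultimately show ?thesis
    using assms(2) by (simp only: gbinomial_pochhammer') simp
qed

text \<open>The formal series of 0F1(; a; z t) in t, with \<open>z\<close> kept as a
  parameter.\<close>

definition fps_0F1 :: "'a::field_char_0 \<Rightarrow> 'a \<Rightarrow> 'a fps" where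
  "fps_0F1 a z = Abs_fps (\<lambda>k. z ^ k / (pochhammer a k * fact k))"

lemma fps_0F1_mult_nth:
  fixes a b :: "'a::field_char_0"
  assumes "a \<notin> \<int>\<^sub>\<le>\<^sub>0" and "b \<notin> \<int>\<^sub>\<le>\<^sub>0"
  shows "fps_nth (fps_0F1 b z * fps_0F1 a z) n =
           pochhammer (a + b + of_nat n - 1) n * z ^ n
             / (fact n * pochhammer a n * pochhammer b n)"
proof -
  have a: "pochhammer a k \<noteq> 0" and b: "pochhammer b k \<noteq> 0" for k
    using assms pochhammer_eq_0_imp_nonpos_Int by blast+
  have summand: "z ^ i / (pochhammer b i * fact i) * (z ^ (n - i) / (pochhammer a (n - i) * fact (n - i)))
      = (((a + of_nat n - 1) gchoose i) * ((b + of_nat n - 1) gchoose (n - i)))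
          * (z ^ n / (pochhammer a n * pochhammer b n))" if "i \<le> n" for i
  proof -
    have "z ^ n = z ^ i * z ^ (n - i)"
      using that by (simp flip: power_add)
    moreover have "(a + of_nat n - 1) gchoose i = pochhammer a n / (pochhammer a (n - i) * fact i)"
      using that a by (intro gbinomial_shifted)
    \<comment> \<open>The same identity with n - i for i, as n - (n - i) = i.\<close>
    moreover have "(b + of_nat n - 1) gchoose (n - i) = pochhammer b n / (pochhammer b i * fact (n - i))"
      using gbinomial_shifted[of "n - i" n b] that b by simp
    ultimately show ?thesis
      using a[of n] b[of n] by (simp add: field_simps)
  qed
  have "fps_nth (fps_0F1 b z * fps_0F1 a z) n
      = (\<Sum>i=0..n. ((a + of_nat n - 1) gchoose i) * ((b + of_nat n - 1) gchoose (n - i)))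
          * (z ^ n / (pochhammer a n * pochhammer b n))"
    unfolding fps_mult_nth fps_0F1_def fps_nth_Abs_fps sum_distrib_right
    by (intro sum.cong refl summand) simp
  also have "\<dots> = ((a + of_nat n - 1 + (b + of_nat n - 1)) gchoose n)
          * (z ^ n / (pochhammer a n * pochhammer b n))"
    by (simp only: gbinomial_Vandermonde)
  \<comment> \<open>The base at which \<open>gbinomial_pochhammer'\<close> starts the rising
    product.\<close>
  also have "a + of_nat n - 1 + (b + of_nat n - 1) - of_nat n + 1 = a + b + of_nat n - 1"
    by (simp add: algebra_simps)
  then have "(a + of_nat n - 1 + (b + of_nat n - 1)) gchoose n
      = pochhammer (a + b + of_nat n - 1) n / fact n"
    by (simp only: gbinomial_pochhammer')
  finally show ?thesis
    by (simp add: mult_ac)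
qed

text \<open>Both sides expand the same function, and expansions are unique. Composing with
  \<open>fps_X ^ 2\<close> makes it visible that exp(-t^2) has no odd coefficients.\<close>

lemma hermite_fps:
  "Abs_fps (\<lambda>n. hermite n z / fact n) = fps_exp (2 * z) * (fps_exp (-1) oo fps_X ^ 2)"
proof -
  let ?f = "\<lambda>t. exp (2 * z * t - t ^ 2)"
  have 1: "?f has_fps_expansion Abs_fps (\<lambda>n. hermite n z / fact n)"
    using hermite_sums[of z] by (intro has_fps_expansionI always_eventually) simp
  have "((\<lambda>t. exp ((-1) * t)) \<circ> (\<lambda>t::complex. t ^ 2))
      has_fps_expansion (fps_exp (-1) oo fps_X ^ 2)"
    by (intro has_fps_expansion_compose has_fps_expansion_power has_fps_expansion_fps_X
        has_fps_expansion_exp) simp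
  hence "(\<lambda>t. exp (2 * z * t) * ((\<lambda>t. exp ((-1) * t)) \<circ> (\<lambda>t. t ^ 2)) t)
      has_fps_expansion fps_exp (2 * z) * (fps_exp (-1) oo fps_X ^ 2)"
    by (intro has_fps_expansion_mult has_fps_expansion_exp)
  also have "(\<lambda>t. exp (2 * z * t) * ((\<lambda>t. exp ((-1) * t)) \<circ> (\<lambda>t. t ^ 2)) t) = ?f"
    by (auto simp: fun_eq_iff exp_diff exp_minus divide_inverse)
  finally show ?thesis
    using 1 fps_expansion_unique_complex by blast
qed

text \<open>As exp(-t^2) is even, the even coefficients of exp(2zt) exp(-t^2) see only cosh(2zt).
  With t in place of t^2 this factor becomes cosh(2z sqrt t) = 0F1(; 1/2; z^2 t).\<close>

lemma hermite_even_fps: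
  "Abs_fps (\<lambda>m. hermite (2 * m) z / fact (2 * m)) = fps_0F1 (1/2) (z ^ 2) * fps_exp (-1)"
proof (rule fps_ext)
  fix m
  have "hermite (2 * m) z / fact (2 * m) = fps_nth (Abs_fps (\<lambda>n. hermite n z / fact n)) (2 * m)"
    by simp
  also have "\<dots> = (\<Sum>j=0..2*m. (2 * z) ^ j / fact j *
      (if even (2 * m - j) then (-1) ^ ((2 * m - j) div 2) / fact ((2 * m - j) div 2) else 0))"
    unfolding hermite_fps fps_mult_nth fps_nth_compose_X_power by (simp cong: if_cong)
  also have "\<dots> = (\<Sum>i=0..m. (2 * z) ^ (2 * i) / fact (2 * i) * ((-1) ^ (m - i) / fact (m - i)))"
  \<comment> \<open>Substitute j = 2i; the odd j, collected in \<open>T'\<close>, contribute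
    0.\<close>
  proof (rule sum.reindex_bij_witness_not_neutral[symmetric,
        where S' = "{}" and T' = "{j\<in>{0..2*m}. odd j}" and i = "\<lambda>j. j div 2" and j = "\<lambda>i. 2 * i"])
    fix i assume "i \<in> {0..m}"
    hence "2 * m - 2 * i = 2 * (m - i)" by simp
    thus "(2 * z) ^ (2 * i) / fact (2 * i) *
      (if even (2 * m - 2 * i) then (-1) ^ ((2 * m - 2 * i) div 2) / fact ((2 * m - 2 * i) div 2) else 0)
      = (2 * z) ^ (2 * i) / fact (2 * i) * ((-1) ^ (m - i) / fact (m - i))"
      by simp
  qed auto
  \<comment> \<open>The powers of 2 cancel by (2i)! = 4^i (1/2,i) i!.\<close>
  also have "\<dots> = fps_nth (fps_0F1 (1/2) (z ^ 2) * fps_exp (-1)) m"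
    unfolding fps_mult_nth fps_0F1_def
    by (intro sum.cong refl) (simp add: fact_double power_mult_distrib power_mult)
  finally show "fps_nth (Abs_fps (\<lambda>m. hermite (2 * m) z / fact (2 * m))) m
      = fps_nth (fps_0F1 (1/2) (z ^ 2) * fps_exp (-1)) m"
    by simp
qed

text \<open>Once (a,n) is divided out, the k-th Laguerre term splits into a factor in k and a factor
  in n - k, so the sum is a Cauchy product.\<close>

lemma laguerre_fps:
  assumes "a \<notin> \<int>\<^sub>\<le>\<^sub>0"
  shows "Abs_fps (\<lambda>n. laguerre n (a - 1) (- y) / pochhammer a n) = fps_exp 1 * fps_0F1 a y"
proof (rule fps_ext)
  fix n
  have a: "pochhammer a k \<noteq> 0" for k
    using assms pochhammer_eq_0_imp_nonpos_Int by blast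
  \<comment> \<open>Here (-n,k) = (-1)^k n! / (n-k)!, and the sign cancels that of (-y)^k.\<close>
  have eq: "pochhammer (- of_nat n) k * (- y) ^ k / fact n = y ^ k / fact (n - k)"
    if "k \<le> n" for k
  proof -
    have "pochhammer (- of_nat n :: complex) k = (-1) ^ k * pochhammer (of_nat (n - k) + 1) k"
      using that by (simp add: pochhammer_minus of_nat_diff)
    moreover have "(fact n :: complex) = fact (n - k) * pochhammer (of_nat (n - k) + 1) k"
      using that pochhammer_product'[of "1::complex" "n - k" k]
      by (simp add: pochhammer_fact add.commute)
    moreover have "(- y) ^ k = (-1) ^ k * y ^ k"
      by (simp flip: power_mult_distrib)
    ultimately show ?thesis
      using fact_nonzero[of n, where 'a = complex] by (simp add: field_simps)
  qed
  have "pochhammer (- of_nat n) k * pochhammer a n / (pochhammer a k * fact k) * (- y) ^ k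
      / fact n / pochhammer a n = y ^ k / (pochhammer a k * fact k) * (1 / fact (n - k))"
    if "k \<le> n" for k
  proof -
    have "pochhammer (- of_nat n) k * pochhammer a n / (pochhammer a k * fact k) * (- y) ^ k
        / fact n / pochhammer a n
      = (pochhammer (- of_nat n) k * (- y) ^ k / fact n) / (pochhammer a k * fact k)"
      using a[of n] by (simp add: mult_ac)
    thus ?thesis
      by (simp only: eq[OF that]) (simp add: mult_ac)
  qed
  hence "laguerre n (a - 1) (- y) / pochhammer a n
      = (\<Sum>k=0..n. y ^ k / (pochhammer a k * fact k) * (1 / fact (n - k)))"
    unfolding laguerre_def by (simp add: sum_distrib_left sum_divide_distrib mult.commute)
  also have "\<dots> = fps_nth (fps_0F1 a y * fps_exp 1) n"
    by (simp add: fps_mult_nth fps_0F1_def)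
  finally show "fps_nth (Abs_fps (\<lambda>n. laguerre n (a - 1) (- y) / pochhammer a n)) n
      = fps_nth (fps_exp 1 * fps_0F1 a y) n"
    by (simp add: mult.commute)
qed

text \<open>With Laguerre argument -(s^2), both 0F1 factors have the argument s^2 t, as the product
  formula demands once the exponentials have cancelled.\<close>

lemma hermite_laguerre_convolution:
  assumes "a \<notin> \<int>\<^sub>\<le>\<^sub>0"
  shows "(\<Sum>m=0..n. hermite (2 * m) s / fact (2 * m)
             * (laguerre (n - m) (a - 1) (- (s ^ 2)) / pochhammer a (n - m)))
       = pochhammer (a - 1/2 + of_nat n) n * (s ^ 2) ^ n
           / (fact n * pochhammer a n * pochhammer (1/2) n)"
proof -
  have half: "(1/2 :: complex) \<notin> \<int>\<^sub>\<le>\<^sub>0"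
    by (auto elim!: nonpos_Ints_cases simp: complex_eq_iff)
  have "(\<Sum>m=0..n. hermite (2 * m) s / fact (2 * m)
             * (laguerre (n - m) (a - 1) (- (s ^ 2)) / pochhammer a (n - m)))
      = fps_nth (Abs_fps (\<lambda>m. hermite (2 * m) s / fact (2 * m))
          * Abs_fps (\<lambda>n. laguerre n (a - 1) (- (s ^ 2)) / pochhammer a n)) n"
    by (simp add: fps_mult_nth)
  also have "\<dots> = fps_nth (fps_0F1 (1/2) (s ^ 2) * (fps_exp (-1) * fps_exp 1) * fps_0F1 a (s ^ 2)) n"
    by (simp only: hermite_even_fps laguerre_fps[OF assms] mult.assoc)
  also have "fps_exp (-1) * fps_exp (1::complex) = 1"
    using fps_exp_add_mult[of "-1::complex" 1] by simp
  also have "fps_nth (fps_0F1 (1/2) (s ^ 2) * 1 * fps_0F1 a (s ^ 2)) n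
      = pochhammer (a + 1/2 + of_nat n - 1) n * (s ^ 2) ^ n
          / (fact n * pochhammer a n * pochhammer (1/2) n)"
    by (simp only: mult_1_right fps_0F1_mult_nth[OF assms half])
  also have "a + 1/2 + of_nat n - 1 = a - 1/2 + of_nat n"
    by simp
  finally show ?thesis .
qed

text \<open>The odd Taylor coefficients of cosine are 0, so reindexing by n -> 2n keeps the
  sum.\<close>

lemma cos_sums_even: "(\<lambda>n. (-1) ^ n / fact (2 * n) * z ^ (2 * n)) sums cos z"
  for z :: complex
proof -
  have "(\<lambda>n. cos_coeff (2 * n) *\<^sub>R z ^ (2 * n)) sums cos z"
    using cos_converges[of z]
    by (subst sums_mono_reindex[of "\<lambda>n. 2 * n"])
       (auto simp: strict_mono_def cos_coeff_def image_iff elim!: evenE)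
  thus ?thesis
    by (simp add: cos_coeff_def scaleR_conv_of_real)
qed

theorem mainTheorem10:
  fixes p' x y sx sy :: complex
  assumes "p' \<notin> \<int>\<^sub>\<le>\<^sub>0" and "p' - 1/2 \<notin> \<int>\<^sub>\<le>\<^sub>0"
    and "sx ^ 2 = x" and "sy ^ 2 = y"
  shows "(\<lambda>N. (\<Sum>(m, n) \<in> {(m, n). m + n = N}.
            pochhammer p' (m + n) * pochhammer (p' - 1/2) (m + n) * (-1) ^ (m + n)
              / (2 ^ (2 * m)
                 * pochhammer ((2 * p' - 1) / 4) (m + n) * pochhammer ((2 * p' + 1) / 4) (m + n)
                 * pochhammer (1/2) m * pochhammer p' n * fact m)
            * hermite (2 * m) sy * laguerre n (p' - 1) (- y)) * x ^ N)
         sums cos (4 * sx * sy)"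
proof -
  have coeff: "(\<Sum>(m, n) \<in> {(m, n). m + n = N}.
            pochhammer p' (m + n) * pochhammer (p' - 1/2) (m + n) * (-1) ^ (m + n)
              / (2 ^ (2 * m)
                 * pochhammer ((2 * p' - 1) / 4) (m + n) * pochhammer ((2 * p' + 1) / 4) (m + n)
                 * pochhammer (1/2) m * pochhammer p' n * fact m)
            * hermite (2 * m) sy * laguerre n (p' - 1) (- y))
          = (-1) ^ N * 16 ^ N * y ^ N / fact (2 * N)" (is "?S = _") for N
  proof -
    have nz: "pochhammer p' N \<noteq> 0" "pochhammer (p' - 1/2) (2 * N) \<noteq> 0"
      using assms pochhammer_eq_0_imp_nonpos_Int by blast+
    define Q where "Q = pochhammer ((2 * p' - 1) / 4) N * pochhammer ((2 * p' + 1) / 4) N"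
    \<comment> \<open>The two bases differ by 1/2 and the first is half of p' - 1/2, so the
      duplication formula applies to \<open>Q\<close>; with \<open>nz\<close> it also gives
      \<open>Q\<close> \<noteq> 0.\<close>
    have "2 * ((2 * p' - 1) / 4) = p' - 1/2" "(2 * p' - 1) / 4 + 1/2 = (2 * p' + 1) / 4"
      by (simp_all add: field_simps)
    with pochhammer_double[of "(2 * p' - 1) / 4" N]
    have double: "pochhammer (p' - 1/2) (2 * N) = 4 ^ N * Q"
      by (simp only: Q_def power_mult mult.assoc) simp
    \<comment> \<open>The first factor comes from the summand, the second from the convolution;
      joined, they cancel \<open>Q\<close> up to 4^N.\<close>
    have split: "pochhammer (p' - 1/2) (2 * N)
        = pochhammer (p' - 1/2) N * pochhammer (p' - 1/2 + of_nat N) N"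
      using pochhammer_product'[of "p' - 1/2" N N] by (simp add: mult_2)
    \<comment> \<open>\<open>C\<close> gathers what depends on m + n = N alone.\<close>
    define C where "C = pochhammer p' N * pochhammer (p' - 1/2) N * (-1) ^ N / Q"
    \<comment> \<open>The rest of the denominator, 2^(2m) (1/2,m) m!, becomes (2m)!;
      \<open>m * 2\<close> is the order that \<open>mult_ac\<close> produces.\<close>
    have fact2: "fact (m * 2) = (2 ^ (m * 2) * pochhammer (1/2) m * fact m :: complex)" for m
      using fact_double[of m] by (simp only: mult.commute[of m 2])
    have "?S = (\<Sum>m=0..N. C * (hermite (2 * m) sy / fact (2 * m)
             * (laguerre (N - m) (p' - 1) (- (sy ^ 2)) / pochhammer p' (N - m))))"
      by (rule sum.reindex_bij_witness[where i = "\<lambda>m. (m, N - m)" and j = fst])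
         (auto simp: C_def Q_def fact2 assms(4) mult_ac)
    also have "\<dots> = C * (pochhammer (p' - 1/2 + of_nat N) N * y ^ N
           / (fact N * pochhammer p' N * pochhammer (1/2) N))"
      by (simp only: hermite_laguerre_convolution[OF assms(1), of sy N, unfolded assms(4)] assms(4)
          flip: sum_distrib_left)
    also have "\<dots> = (-1) ^ N * y ^ N * (pochhammer (p' - 1/2) (2 * N) / Q)
           / (fact N * pochhammer (1/2) N)"
      using nz(1) unfolding C_def split by (simp add: mult_ac)
    also have "\<dots> = (-1) ^ N * y ^ N * 4 ^ N / (fact N * pochhammer (1/2) N)"
      using nz(2) by (simp add: double)
    also have "\<dots> = (-1) ^ N * 16 ^ N * y ^ N / fact (2 * N)"
    proof -
      \<comment> \<open>One 4^N stems from the duplication, the other from (2N)! = 4^N (1/2,N)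
        N!.\<close>
      have "(16::complex) ^ N = 4 ^ N * 4 ^ N"
        by (simp flip: power_mult_distrib)
      thus ?thesis
        by (simp add: fact_double power_mult) (simp add: mult_ac)
    qed
    finally show ?thesis .
  qed
  \<comment> \<open>Only even powers of \<open>sx\<close> and \<open>sy\<close> occur, so any choice
    of square roots works.\<close>
  have "(4 * sx * sy) ^ (2 * N) = 16 ^ N * y ^ N * x ^ N" for N
    by (simp add: power_mult power_mult_distrib assms(3,4))
  with cos_sums_even[of "4 * sx * sy"] show ?thesis
    unfolding coeff by (simp add: mult_ac)
qed

end
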